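(* Let $(p_n)_{n\ge 0}$ be one of the three classical orthogonal polynomial families (Jacobi, Laguerre or Hermite), with data $\sigma,\tau,\lambda_n$ as in the context, let $c\in\mathbb{N}_0$, and let $p_n(x;c)$ be the associated polynomials of order $c$. Write $\mathcal{D}=\frac{d}{dx}$ and $\mathcal{I}$ for the identity, and let $$\mathcal{A} = -\sigma^2\mathcal{D}^4 - 5\sigma\sigma'\mathcal{D}^3 + \left[\tau^2+2\tau'\sigma-2\tau\sigma'-6\sigma\sigma''+4\lambda_{c-1}\sigma-3\sigma'^2\right]\mathcal{D}^2 + 3\left[\tau\tau'+2\lambda_{c-1}\sigma'-(\tau+\sigma')\sigma''\right]\mathcal{D} + \left[2\lambda_{c-1}\sigma''-\tau'(\sigma''-\tau')\right]\mathcal{I},$$ $$\mathcal{B} = 2\sigma\mathcal{D}^2+3\sigma'\mathcal{D}+\sigma''\mathcal{I}.$$ The quadratic eigenvalues $\{\lambda_n^\pm\}_{n=0}^\infty$ of the problem defined by $$\{\mathcal{A}+\lambda_n^\pm\mathcal{B}\}\,p_n^\pm(x;c)=(\lambda_n^\pm)^2\,p_n^\pm(x;c)$$ satisfy $$2\lambda_n^\pm = \sigma''(n+1)^2 \pm (n+1)\sqrt{(\sigma''-2\tau')^2+8\lambda_{c-1}\sigma''} = \pm(n+1)\left\{\left[2c-3\pm(n+1)\right]\sigma''+2\tau'\right\}.$$ In particular, it follows from $\lambda_n^+=\lambda_{n+c}-\lambda_{c-1}>0$ that $p_n^+(x;c)=p_n(x;c)$, the associated classical orthogonal polynomials, and the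 fourth-order differential equation $$\Big\{-\sigma^2\mathcal{D}^4-5\sigma\sigma'\mathcal{D}^3+\left[\tau^2+2\tau'\sigma-2\tau\sigma'-6\sigma\sigma''+2(\lambda_{n+c}+\lambda_{c-1})\sigma-3\sigma'^2\right]\mathcal{D}^2+3\left[\tau\tau'+(\lambda_{n+c}+\lambda_{c-1})\sigma'-(\tau+\sigma')\sigma''\right]\mathcal{D}\Big\}p_n(x;c)$$ $$=\left[(\lambda_{n+c}-\lambda_{c-1})^2-(\lambda_{n+c}+\lambda_{c-1})\sigma''+\tau'(\sigma''-\tau')\right]p_n(x;c)$$ satisfied by the associated classical orthogonal polynomials is alternatively formulated as a quadratic eigenvalue problem with known eigenvalues.
   Context: **Classical data.** A classical family satisfies $p_{n+1}(x)=(A_nx+B_n)p_n(x)-C_np_{n-1}(x)$, $p_0=1$, $p_{-1}=0$, and $(\sigma\mathcal{D}^2+\tau\mathcal{D})p_n=\lambda_np_n$, where $\sigma,\tau$ are polynomials in $x$ independent of $n$ with $\deg\sigma\le2$, $\deg\tau\le1$ (so $\sigma''$ and $\tau'$ are constants), and $\lambda_n=\frac n2[(n-1)\sigma''+2\tau']$; the same formula gives the meaning of $\lambda_{c-1}$. The three cases are: - Jacobi $P_n^{(\alpha,\beta)}$, $\alpha,\beta>-1$: $\sigma=x^2-1$, $\tau=\alpha-\beta+(\alpha+\beta+2)x$, $\lambda_n=n(n+\alpha+\beta+1)$, $A_n=\frac{(2n+\alpha+\beta+1)(2n+\alpha+\beta+2)}{2(n+1)(n+\alpha+\beta+1)}$,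 $B_n=\frac{(\alpha^2-\beta^2)(2n+\alpha+\beta+1)}{2(n+1)(n+\alpha+\beta+1)(2n+\alpha+\beta)}$, $C_n=\frac{(n+\alpha)(n+\beta)(2n+\alpha+\beta+2)}{(n+1)(n+\alpha+\beta+1)(2n+\alpha+\beta)}$. - Laguerre $L_n^{(\alpha)}$, $\alpha>-1$: $\sigma=-x$, $\tau=x-\alpha-1$, $\lambda_n=n$, $A_n=-\frac1{n+1}$, $B_n=\frac{2n+\alpha+1}{n+1}$, $C_n=\frac{n+\alpha}{n+1}$. - Hermite $H_n$: $\sigma=-1$, $\tau=2x$, $\lambda_n=2n$, $A_n=2$, $B_n=0$, $C_n=2n$. **Associated polynomials.** For an order of association $c\in\mathbb{N}_0$, $p_n(x;c)$ is defined by $p_0(x;c)=1$, $p_{-1}(x;c)=0$ and $p_{n+1}(x;c)=(A_{n+c}x+B_{n+c})p_n(x;c)-C_{n+c}p_{n-1}(x;c)$. **Quadratic eigenvalues.** $\mathcal{A}$ and $\mathcal{B}$ are degree-preserving: $\mathcal{A}x^n=a_nx^n+(\text{lower degree})$ and $\mathcal{B}x^n=b_nx^n+(\text{lower degree})$ for constants $a_n,b_n$. The quadratic eigenvalues $\lambda_n^\pm$ are the two roots of $a_n+b_n\lambda=\lambda^2$, and $p_n^\pm(x;c)$ denote corresponding polynomial eigenfunctions of degree $n$.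
   Formalization: For Jacobi: the root takes a minus sign if 2c+α+β<1; λ_n^+>0 fails exactly if c=0, n+α+β≤0; p_n^+=p_n(x;c) is unique up to scale except c=0 with α+β=0, n≥1 or α+β=-1, n≥2 (still an eigenfunction); A_0, B_0 use cancelled quotients. *)

theory Defs
  imports Complex_Main "HOL-Computational_Algebra.Polynomial"
begin

datatype classical = Jacobi real real | Laguerre real | Hermite

fun admissible :: "classical \<Rightarrow> bool" where
  "admissible (Jacobi \<alpha> \<beta>) \<longleftrightarrow> \<alpha> > -1 \<and> \<beta> > -1"
| "admissible (Laguerre \<alpha>) \<longleftrightarrow> \<alpha> > -1"
| "admissible Hermite \<longleftrightarrow> True"

fun sigma :: "classical \<Rightarrow> real poly" where
  "sigma (Jacobi \<alpha> \<beta>) = [:-1, 0, 1:]"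
| "sigma (Laguerre \<alpha>) = [:0, -1:]"
| "sigma Hermite = [:-1:]"

fun tau :: "classical \<Rightarrow> real poly" where
  "tau (Jacobi \<alpha> \<beta>) = [:\<alpha> - \<beta>, \<alpha> + \<beta> + 2:]"
| "tau (Laguerre \<alpha>) = [:- \<alpha> - 1, 1:]"
| "tau Hermite = [:0, 2:]"

text \<open>
  Recurrence coefficients. In the Jacobi case the general quotients for \<open>A\<^sub>n\<close> and \<open>B\<^sub>n\<close> read
  \<open>0/0\<close> at \<open>n = 0\<close> when \<open>\<alpha> + \<beta> = -1\<close> or \<open>\<alpha> + \<beta> = 0\<close>; at \<open>n = 0\<close> we therefore use the quotients
  after cancelling the common factors \<open>\<alpha> + \<beta> + 1\<close> and \<open>\<alpha> + \<beta>\<close>. All other denominators are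
  nonzero for admissible parameters, except in \<open>C\<^sub>0\<close>, which is only ever multiplied by \<open>p\<^sub>-\<^sub>1 = 0\<close>.
\<close>

fun rec_A :: "classical \<Rightarrow> nat \<Rightarrow> real" where
  "rec_A (Jacobi \<alpha> \<beta>) n =
     (if n = 0 then (\<alpha> + \<beta> + 2) / 2
      else (2 * real n + \<alpha> + \<beta> + 1) * (2 * real n + \<alpha> + \<beta> + 2)
             / (2 * (real n + 1) * (real n + \<alpha> + \<beta> + 1)))"
| "rec_A (Laguerre \<alpha>) n = - 1 / (real n + 1)"
| "rec_A Hermite n = 2"

fun rec_B :: "classical \<Rightarrow> nat \<Rightarrow> real" where
  "rec_B (Jacobi \<alpha> \<beta>) n =
     (if n = 0 then (\<alpha> - \<beta>) / 2
      else (\<alpha>\<^sup>2 - \<beta>\<^sup>2) * (2 * real n + \<alpha> + \<beta> + 1)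
             / (2 * (real n + 1) * (real n + \<alpha> + \<beta> + 1) * (2 * real n + \<alpha> + \<beta>)))"
| "rec_B (Laguerre \<alpha>) n = (2 * real n + \<alpha> + 1) / (real n + 1)"
| "rec_B Hermite n = 0"

fun rec_C :: "classical \<Rightarrow> nat \<Rightarrow> real" where
  "rec_C (Jacobi \<alpha> \<beta>) n =
     (real n + \<alpha>) * (real n + \<beta>) * (2 * real n + \<alpha> + \<beta> + 2)
       / ((real n + 1) * (real n + \<alpha> + \<beta> + 1) * (2 * real n + \<alpha> + \<beta>))"
| "rec_C (Laguerre \<alpha>) n = (real n + \<alpha>) / (real n + 1)"
| "rec_C Hermite n = 2 * real n"

text \<open>
  \<open>assoc F c n\<close> is \<open>p\<^sub>n(x;c)\<close>; the second equation is the recurrence at \<open>n = 0\<close> with \<open>p\<^sub>-\<^sub>1 = 0\<close>.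
  The classical polynomials themselves are \<open>assoc F 0\<close>.
\<close>

fun assoc :: "classical \<Rightarrow> nat \<Rightarrow> nat \<Rightarrow> real poly" where
  "assoc F c 0 = 1"
| "assoc F c (Suc 0) = [:rec_B F c, rec_A F c:]"
| "assoc F c (Suc (Suc n)) =
     [:rec_B F (Suc n + c), rec_A F (Suc n + c):] * assoc F c (Suc n)
       - smult (rec_C F (Suc n + c)) (assoc F c n)"

text \<open>The constants \<open>\<sigma>''\<close> and \<open>\<tau>'\<close>, for \<open>deg \<sigma> \<le> 2\<close> and \<open>deg \<tau> \<le> 1\<close>.\<close>

definition d2 :: "real poly \<Rightarrow> real" where
  "d2 \<sigma> = coeff (pderiv (pderiv \<sigma>)) 0"

definition d1 :: "real poly \<Rightarrow> real" where
  "d1 \<tau> = coeff (pderiv \<tau>) 0"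

text \<open>\<open>\<lambda>\<^sub>x\<close> takes a real index, because \<open>\<lambda>\<^sub>c\<^sub>-\<^sub>1\<close> with \<open>c = 0\<close> means the value of the formula at \<open>-1\<close>.\<close>

definition eigval :: "real poly \<Rightarrow> real poly \<Rightarrow> real \<Rightarrow> real" where
  "eigval \<sigma> \<tau> x = x / 2 * ((x - 1) * d2 \<sigma> + 2 * d1 \<tau>)"

definition op_A :: "real poly \<Rightarrow> real poly \<Rightarrow> nat \<Rightarrow> real poly \<Rightarrow> real poly" where
  "op_A \<sigma> \<tau> c p =
     (let \<sigma>' = pderiv \<sigma>; \<sigma>'' = d2 \<sigma>; \<tau>' = d1 \<tau>; l = eigval \<sigma> \<tau> (real c - 1) in
      - (\<sigma>\<^sup>2 * (pderiv ^^ 4) p)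
      - 5 * \<sigma> * \<sigma>' * (pderiv ^^ 3) p
      + (\<tau>\<^sup>2 + smult (2 * \<tau>') \<sigma> - 2 * \<tau> * \<sigma>' - smult (6 * \<sigma>'') \<sigma> + smult (4 * l) \<sigma> - 3 * \<sigma>'\<^sup>2)
          * (pderiv ^^ 2) p
      + 3 * (smult \<tau>' \<tau> + smult (2 * l) \<sigma>' - smult \<sigma>'' (\<tau> + \<sigma>')) * pderiv p
      + smult (2 * l * \<sigma>'' - \<tau>' * (\<sigma>'' - \<tau>')) p)"

definition op_B :: "real poly \<Rightarrow> real poly \<Rightarrow> real poly" where
  "op_B \<sigma> p = 2 * \<sigma> * (pderiv ^^ 2) p + 3 * pderiv \<sigma> * pderiv p + smult (d2 \<sigma>) p"

definition degree_preserving :: "(real poly \<Rightarrow> real poly) \<Rightarrow> bool" where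
  "degree_preserving T \<longleftrightarrow> (\<forall>n. degree (T (monom 1 n)) \<le> n)"

text \<open>The constant \<open>t\<^sub>n\<close> in \<open>T x\<^sup>n = t\<^sub>n x\<^sup>n + (lower degree)\<close>; it may be zero.\<close>

definition diag :: "(real poly \<Rightarrow> real poly) \<Rightarrow> nat \<Rightarrow> real" where
  "diag T n = coeff (T (monom 1 n)) n"

text \<open>\<open>l\<^sub>1, l\<^sub>2\<close> are the two roots, counted with multiplicity, of \<open>a\<^sub>n + b\<^sub>n x = x\<^sup>2\<close>.\<close>

definition quadratic_eigenvalues ::
  "(real poly \<Rightarrow> real poly) \<Rightarrow> (real poly \<Rightarrow> real poly) \<Rightarrow> nat \<Rightarrow> real \<Rightarrow> real \<Rightarrow> bool" where
  "quadratic_eigenvalues A B n l\<^sub>1 l\<^sub>2 \<longleftrightarrow>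
     (\<forall>x. x\<^sup>2 - (diag A n + diag B n * x) = (x - l\<^sub>1) * (x - l\<^sub>2))"

definition quadratic_eigen_eq ::
  "(real poly \<Rightarrow> real poly) \<Rightarrow> (real poly \<Rightarrow> real poly) \<Rightarrow> real \<Rightarrow> real poly \<Rightarrow> bool" where
  "quadratic_eigen_eq A B l p \<longleftrightarrow> A p + smult l (B p) = smult (l\<^sup>2) p"

definition quadratic_eigenfunction ::
  "(real poly \<Rightarrow> real poly) \<Rightarrow> (real poly \<Rightarrow> real poly) \<Rightarrow> nat \<Rightarrow> real \<Rightarrow> real poly \<Rightarrow> bool" where
  "quadratic_eigenfunction A B n l p \<longleftrightarrow> p \<noteq> 0 \<and> degree p = n \<and> quadratic_eigen_eq A B l p"

definition fourth_order_eq :: "real poly \<Rightarrow> real poly \<Rightarrow> nat \<Rightarrow> nat \<Rightarrow> real poly \<Rightarrow> bool" where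
  "fourth_order_eq \<sigma> \<tau> c n p \<longleftrightarrow>
     (let \<sigma>' = pderiv \<sigma>; \<sigma>'' = d2 \<sigma>; \<tau>' = d1 \<tau>;
          l = eigval \<sigma> \<tau> (real c - 1); m = eigval \<sigma> \<tau> (real (n + c)) in
      - (\<sigma>\<^sup>2 * (pderiv ^^ 4) p)
      - 5 * \<sigma> * \<sigma>' * (pderiv ^^ 3) p
      + (\<tau>\<^sup>2 + smult (2 * \<tau>') \<sigma> - 2 * \<tau> * \<sigma>' - smult (6 * \<sigma>'') \<sigma> + smult (2 * (m + l)) \<sigma>
           - 3 * \<sigma>'\<^sup>2) * (pderiv ^^ 2) p
      + 3 * (smult \<tau>' \<tau> + smult (m + l) \<sigma>' - smult \<sigma>'' (\<tau> + \<sigma>')) * pderiv p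
      = smult ((m - l)\<^sup>2 - (m + l) * \<sigma>'' + \<tau>' * (\<sigma>'' - \<tau>')) p)"

end

theory Submission
  imports Defs
begin

text \<open>
  Let \<open>w\<close> be the weight of the classical family. Up to a constant, \<open>p\<^sub>n(x;c)\<close> is an antisymmetrised
  product \<open>w y z\<close> of solutions \<open>y\<close>, \<open>z\<close> of the classical equation with eigenvalues
  \<open>\<mu> = \<lambda>\<^sub>n\<^sub>+\<^sub>c\<close> and \<open>\<nu> = \<lambda>\<^sub>c\<^sub>-\<^sub>1\<close>. With \<open>f = w y z\<close>, \<open>r = w \<sigma> y z'\<close>,
  \<open>k = \<sigma> f' + (\<sigma>' - \<tau>) f\<close> and \<open>h = r' - \<nu> f\<close>, the second-order equations give
  \<open>k' = (\<mu> - \<nu>) f + 2 r'\<close> and \<open>\<sigma> h' + \<tau> h = (\<mu> - \<nu>) r + \<nu> k\<close>; differentiating once and eliminating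
  \<open>r\<close> is the fourth-order equation. To avoid functions of the second kind, the polynomial \<open>r\<close> that
  goes with \<open>f = p\<^sub>n(x;c)\<close> is built by the same three-term recurrence, and the first-order relations
  inherited from the lowering and raising relations of the classical polynomials are carried through
  the induction on \<open>n\<close>.

  The quadratic eigenvalue part is linear algebra: on polynomials the pencil
  \<open>\<A> + l \<B> - l\<^sup>2\<close> is triangular with diagonal entries \<open>-(l - \<lambda>\<^sub>k\<^sup>+)(l - \<lambda>\<^sub>k\<^sup>-)\<close>.
\<close>

section \<open>The fourth-order equation in factored form\<close>

text \<open>For a weight w with (\<sigma> w)' = \<tau> w, \<open>k\<close> is \<sigma> w (p/w)'. If
  p = w y z, where y and z solve the classical equation with eigenvalues \<open>m\<close> and
  \<open>l\<close>, then \<open>g\<close> is 2 \<sigma> w y' z'. The equivalence itself follows by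
  expanding everything in the derivatives of \<open>p\<close>.\<close>

lemma fourth_order_eq_iff:
  assumes "pderiv (pderiv \<sigma>) = [:d2 \<sigma>:]" "pderiv \<tau> = [:d1 \<tau>:]"
    "l = eigval \<sigma> \<tau> (real c - 1)" "m = eigval \<sigma> \<tau> (real (n + c))"
    "k = \<sigma> * pderiv p + (pderiv \<sigma> - \<tau>) * p" "g = pderiv k - smult (m + l) p"
  shows "fourth_order_eq \<sigma> \<tau> c n p \<longleftrightarrow>
    pderiv (\<sigma> * pderiv g + \<tau> * g) = smult (m + l) (pderiv k) - smult ((m - l)\<^sup>2) p"
proof -
  \<comment> \<open>Scalars become constant polynomials with zero derivative, so that the final
    comparison is an identity in a commutative ring.\<close>
  define M L S T where "M = [:m:]" and "L = [:l:]" and "S = [:d2 \<sigma>:]" and "T = [:d1 \<tau>:]"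
  have c0: "pderiv M = 0" "pderiv L = 0" "pderiv S = 0" "pderiv T = 0"
    by (simp_all add: M_def L_def S_def T_def pderiv_pCons)
  have d: "pderiv (pderiv \<sigma>) = S" "pderiv \<tau> = T"
    using assms by (simp_all add: S_def T_def)
  have e1: "smult (2 * d1 \<tau>) q = 2 * T * q" "smult (6 * d2 \<sigma>) q = 6 * S * q"
    "smult (2 * (m + l)) q = 2 * (M + L) * q"
    "smult (d1 \<tau>) q = T * q" "smult (d2 \<sigma>) q = S * q" "smult (m + l) q = (M + L) * q"
    "smult ((m - l)\<^sup>2) q = (M - L)\<^sup>2 * q"
    "smult ((m - l)\<^sup>2 - (m + l) * d2 \<sigma> + d1 \<tau> * (d2 \<sigma> - d1 \<tau>)) q
      = ((M - L)\<^sup>2 - (M + L) * S + T * (S - T)) * q" for q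
    unfolding M_def L_def S_def T_def
    by (simp_all add: numeral_poly power2_eq_square smult_add_left smult_diff_left algebra_simps)
  have p4: "(pderiv ^^ 4) p = pderiv (pderiv (pderiv (pderiv p)))" "(pderiv ^^ 3) p = pderiv (pderiv (pderiv p))"
    "(pderiv ^^ 2) p = pderiv (pderiv p)"
    by (simp_all add: eval_nat_numeral)
  define f1 f2 f3 f4 S1 where "f1 = pderiv p" and "f2 = pderiv f1" and "f3 = pderiv f2" and "f4 = pderiv f3"
    and "S1 = pderiv \<sigma>"
  have dd: "pderiv p = f1" "pderiv f1 = f2" "pderiv f2 = f3" "pderiv f3 = f4"
    "pderiv \<sigma> = S1" "pderiv S1 = S" "pderiv \<tau> = T"
    using d by (simp_all add: f1_def f2_def f3_def f4_def S1_def)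
  have k: "k = \<sigma> * f1 + (S1 - \<tau>) * p"
    by (simp add: assms(5) dd)
  have dk: "pderiv k = \<sigma> * f2 + (2 * S1 - \<tau>) * f1 + (S - T) * p"
    unfolding k by (simp add: pderiv_mult pderiv_add pderiv_diff dd algebra_simps)
  have g: "g = \<sigma> * f2 + (2 * S1 - \<tau>) * f1 + (S - T - M - L) * p"
    unfolding assms(6) dk e1 by (simp add: algebra_simps)
  have dg: "pderiv g = \<sigma> * f3 + (3 * S1 - \<tau>) * f2 + (3 * S - 2 * T - M - L) * f1"
    unfolding g by (simp add: pderiv_mult pderiv_add pderiv_diff dd c0 algebra_simps)
  have ddg: "pderiv (pderiv g) = \<sigma> * f4 + (4 * S1 - \<tau>) * f3 + (6 * S - 3 * T - M - L) * f2"
    unfolding dg by (simp add: pderiv_mult pderiv_add pderiv_diff dd c0 algebra_simps)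
  have "pderiv (\<sigma> * pderiv g + \<tau> * g) = \<sigma> * pderiv (pderiv g) + (S1 + \<tau>) * pderiv g + T * g"
    by (simp add: pderiv_mult pderiv_add dd algebra_simps)
  also have "\<dots> =
      \<sigma> * (\<sigma> * f4 + (4 * S1 - \<tau>) * f3 + (6 * S - 3 * T - M - L) * f2)
      + (S1 + \<tau>) * (\<sigma> * f3 + (3 * S1 - \<tau>) * f2 + (3 * S - 2 * T - M - L) * f1)
      + T * (\<sigma> * f2 + (2 * S1 - \<tau>) * f1 + (S - T - M - L) * p)"
    unfolding ddg unfolding dg unfolding g by (rule refl)
  finally have dL: "pderiv (\<sigma> * pderiv g + \<tau> * g) = \<dots>" .
  \<comment> \<open>The difference changes sign because the equation starts with -\<sigma>^2 D^4
    while the factored form starts with +\<sigma>^2 D^4.\<close>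
  have iff: "a = b \<longleftrightarrow> x = y" if "a - b = y - x" for a b x y :: "real poly"
    using that by auto
  show ?thesis
    unfolding fourth_order_eq_def Let_def assms(3,4)[symmetric] e1 p4 dd dL dk
    by (rule iff) (simp add: field_simps power2_eq_square)
qed

section \<open>Lowering and raising relations of the classical families\<close>

text \<open>
  The coefficients of the classical relations
  \<open>\<sigma> p\<^sub>N' = lower_lin N * p\<^sub>N + lower_const N * p\<^sub>N\<^sub>-\<^sub>1\<close> and
  \<open>\<sigma> p\<^sub>N\<^sub>-\<^sub>1' = raise_lin N * p\<^sub>N\<^sub>-\<^sub>1 + raise_const N * p\<^sub>N\<close>.
\<close>

fun lower_lin :: "classical \<Rightarrow> nat \<Rightarrow> real poly" where
  "lower_lin (Jacobi \<alpha> \<beta>) N = [:- (real N * (\<alpha> - \<beta>) / (2 * real N + \<alpha> + \<beta>)), real N:]"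
| "lower_lin (Laguerre \<alpha>) N = [:- real N:]"
| "lower_lin Hermite N = 0"

fun lower_const :: "classical \<Rightarrow> nat \<Rightarrow> real" where
  "lower_const (Jacobi \<alpha> \<beta>) N = - (2 * (real N + \<alpha>) * (real N + \<beta>) / (2 * real N + \<alpha> + \<beta>))"
| "lower_const (Laguerre \<alpha>) N = real N + \<alpha>"
| "lower_const Hermite N = - (2 * real N)"

definition raise_lin :: "classical \<Rightarrow> nat \<Rightarrow> real poly" where
  "raise_lin F N = pderiv (sigma F) - tau F - lower_lin F N"

fun raise_const :: "classical \<Rightarrow> nat \<Rightarrow> real" where
  "raise_const (Jacobi \<alpha> \<beta>) N = 2 * real N * (real N + \<alpha> + \<beta>) / (2 * real N + \<alpha> + \<beta>)"
| "raise_const (Laguerre \<alpha>) N = - real N"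
| "raise_const Hermite N = 1"

abbreviation "rec_lin F N \<equiv> [:rec_B F N, rec_A F N:]"

lemma jacobi_nonzero:
  fixes \<alpha> \<beta> :: real
  assumes "admissible (Jacobi \<alpha> \<beta>)" "N > 0"
  shows "2 * real N + \<alpha> + \<beta> \<noteq> 0" "real N + \<alpha> + \<beta> + 1 \<noteq> 0"
    "2 + 2 * real N + \<alpha> + \<beta> \<noteq> 0" "2 * real N + \<alpha> + \<beta> + 2 \<noteq> 0"
  using assms by auto

context
  fixes F :: classical and N :: nat
  assumes adm: "admissible F" and N: "N > 0"
begin

text \<open>Inserting the recurrence for p_{N+1} into the raising relation at N+1 must return the
  lowering relation at N; here the coefficients of p_N are compared.\<close>

lemma raise_Suc:
  "raise_lin F (Suc N) + smult (raise_const F (Suc N)) (rec_lin F N) = lower_lin F N"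
proof (cases F)
  case (Jacobi \<alpha> \<beta>)
  note nz = jacobi_nonzero[OF adm[unfolded Jacobi] N]
  show ?thesis
    by (insert N nz;
        simp add: Jacobi raise_lin_def pderiv_pCons;
        (intro conjI)?; simp add: divide_simps; algebra)
qed (use N in \<open>auto simp: raise_lin_def pderiv_pCons divide_simps, auto simp: algebra_simps\<close>)

text \<open>The same substitution, now comparing the coefficients of p_{N-1}.\<close>

lemma raise_const_Suc: "raise_const F (Suc N) * rec_C F N = - lower_const F N"
proof (cases F)
  case (Jacobi \<alpha> \<beta>)
  note nz = jacobi_nonzero[OF adm[unfolded Jacobi] N]
  show ?thesis
    by (insert N nz;
        simp add: Jacobi raise_lin_def pderiv_pCons;
        (intro conjI)?; simp add: divide_simps; algebra)
qed (use N in \<open>auto simp: raise_lin_def pderiv_pCons divide_simps, auto simp: algebra_simps\<close>)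

text \<open>Differentiate the recurrence, multiply by \<sigma> and reduce with the relations at N;
  the coefficient of p_N must agree with the lowering relation at N+1.\<close>

lemma lower_Suc:
  "smult (rec_A F N) (sigma F) + rec_lin F N * lower_lin F N - [:rec_C F N * raise_const F N:]
   = lower_lin F (Suc N) * rec_lin F N + [:lower_const F (Suc N):]"
proof (cases F)
  case (Jacobi \<alpha> \<beta>)
  note nz = jacobi_nonzero[OF adm[unfolded Jacobi] N]
  show ?thesis
    by (insert N nz;
        simp add: Jacobi raise_lin_def pderiv_pCons;
        (intro conjI)?; simp add: divide_simps; algebra)
qed (use N in \<open>auto simp: raise_lin_def pderiv_pCons divide_simps, auto simp: algebra_simps\<close>)

text \<open>Eliminating p_{N-1} from the two relations yields a second-order equation for p_N; this
  identity makes it the classical one.\<close>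

lemma lower_times_raise:
  "lower_lin F N * raise_lin F N - [:lower_const F N * raise_const F N:]
   = sigma F * (pderiv (lower_lin F N) - [:eigval (sigma F) (tau F) (real N):])"
proof (cases F)
  case (Jacobi \<alpha> \<beta>)
  note nz = jacobi_nonzero[OF adm[unfolded Jacobi] N]
  show ?thesis
    by (insert N nz;
        simp add: Jacobi raise_lin_def eigval_def d1_def d2_def power2_eq_square pderiv_pCons;
        (intro conjI)?; simp add: divide_simps; algebra)
qed (use N in \<open>auto simp: raise_lin_def eigval_def d1_def d2_def power2_eq_square pderiv_pCons divide_simps\<close>)

end

text \<open>Eliminating p_N instead gives the equation of p_{N-1}, with eigenvalue \<lambda>_{N-1};
  both eliminations involve the same determinant.\<close>

lemma raise_lower_eigval:
  "pderiv (raise_lin F N) - [:eigval (sigma F) (tau F) (real N - 1):]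
   = pderiv (lower_lin F N) - [:eigval (sigma F) (tau F) (real N):]"
  by (cases F) (auto simp: raise_lin_def eigval_def d1_def d2_def pderiv_pCons field_simps)

text \<open>The raising relation at index 1, where p_0 = 1 and p_1 is
  \<open>rec_lin F 0\<close>.\<close>

lemma raise_one:
  assumes "admissible F"
  shows "raise_lin F 1 + smult (raise_const F 1) (rec_lin F 0) = 0"
proof (cases F)
  case (Jacobi \<alpha> \<beta>)
  then have "2 + \<alpha> + \<beta> \<noteq> 0" using assms by auto
  then show ?thesis
    by (simp add: Jacobi raise_lin_def pderiv_pCons; intro conjI; simp add: divide_simps; algebra)
qed (auto simp: raise_lin_def pderiv_pCons)

text \<open>The lowering relation at index 1: the left-hand side is \<sigma> p_1'.\<close>

lemma lower_one:
  assumes "admissible F"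
  shows "smult (rec_A F 0) (sigma F) = lower_lin F 1 * rec_lin F 0 + [:lower_const F 1:]"
proof (cases F)
  case (Jacobi \<alpha> \<beta>)
  then have "2 + \<alpha> + \<beta> \<noteq> 0" using assms by auto
  then show ?thesis
    by (simp add: Jacobi; intro conjI; simp add: divide_simps; algebra)
qed auto

lemma sigma_nonzero: "sigma F \<noteq> 0"
  by (cases F) auto

lemma pderiv2_sigma: "pderiv (pderiv (sigma F)) = [:d2 (sigma F):]"
  by (cases F) (auto simp: d2_def pderiv_pCons)

lemma pderiv_tau: "pderiv (tau F) = [:d1 (tau F):]"
  by (cases F) (auto simp: d1_def pderiv_pCons)

lemma eigval_0: "eigval \<sigma> \<tau> 0 = 0"
  by (simp add: eigval_def)

lemma eigval_minus_1: "eigval \<sigma> \<tau> (- 1) = d2 \<sigma> - d1 \<tau>"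
  by (simp add: eigval_def field_simps)

section \<open>A first-order system for the associated polynomials\<close>

text \<open>The \<open>g\<close> of the factored form is \<open>2 * h\<close>. Differentiating
  \<open>h'\<close> turns \<open>r\<close> into \<open>pderiv r\<close>, which \<open>k'\<close>
  expresses through \<open>pderiv k\<close> and \<open>p\<close>, so \<open>r\<close>
  disappears.\<close>

lemma fourth_order_eq_pairI:
  assumes \<sigma>: "pderiv (pderiv \<sigma>) = [:d2 \<sigma>:]" and \<tau>: "pderiv \<tau> = [:d1 \<tau>:]"
    and l: "l = eigval \<sigma> \<tau> (real c - 1)" and m: "m = eigval \<sigma> \<tau> (real (n + c))"
    and k: "k = \<sigma> * pderiv p + (pderiv \<sigma> - \<tau>) * p"
    and k': "pderiv k = smult (m - l) p + 2 * pderiv r"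
    and h: "h = pderiv r - smult l p"
    and h': "\<sigma> * pderiv h + \<tau> * h = smult (m - l) r + smult l k"
  shows "fourth_order_eq \<sigma> \<tau> c n p"
proof -
  define g where "g = pderiv k - smult (m + l) p"
  have g: "g = smult 2 h"
    by (rule poly_eqI) (simp add: g_def k' h numeral_poly algebra_simps)
  have "\<sigma> * pderiv g + \<tau> * g = smult 2 (\<sigma> * pderiv h + \<tau> * h)"
    by (simp add: g pderiv_smult smult_add_right)
  then have "pderiv (\<sigma> * pderiv g + \<tau> * g) = smult 2 (smult (m - l) (pderiv r) + smult l (pderiv k))"
    by (simp add: h' pderiv_smult pderiv_add)
  also have "\<dots> = smult (m + l) (pderiv k) - smult ((m - l)\<^sup>2) p"
    by (rule poly_eqI) (simp add: k' numeral_poly algebra_simps power2_eq_square)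
  finally show ?thesis
    using fourth_order_eq_iff[OF \<sigma> \<tau> l m k g_def] by blast
qed

text \<open>
  Formally \<open>f = w y z\<close> and \<open>r = w \<sigma> y z'\<close> with \<open>y = p\<^sub>N\<close>, while \<open>g\<close> and \<open>t\<close> are the same
  expressions with \<open>y = p\<^sub>N\<^sub>-\<^sub>1\<close>; \<open>\<nu>\<close> is the eigenvalue of \<open>z\<close>.
\<close>

definition ladder ::
  "classical \<Rightarrow> nat \<Rightarrow> real \<Rightarrow> real poly \<Rightarrow> real poly \<Rightarrow> real poly \<Rightarrow> real poly \<Rightarrow> bool" where
  "ladder F N \<nu> f g r t \<longleftrightarrow>
     sigma F * pderiv f = - raise_lin F N * f + [:lower_const F N:] * g + r \<and>
     sigma F * pderiv g = - lower_lin F N * g + [:raise_const F N:] * f + t \<and>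
     sigma F * pderiv r = lower_lin F N * r + [:lower_const F N:] * t + [:\<nu>:] * sigma F * f \<and>
     sigma F * pderiv t = raise_lin F N * t + [:raise_const F N:] * r + [:\<nu>:] * sigma F * g"

text \<open>The step from N to N+1 as pure ring algebra: \<open>u\<close>, \<open>uh\<close>,
  \<open>d\<close>, \<open>e\<close> are the lowering and raising coefficients at N, primes mark
  those at N+1, \<open>q\<close>, \<open>A\<close>, \<open>C\<close> come from the recurrence, and
  \<open>f1\<close>, \<open>g1\<close>, \<open>r1\<close>, \<open>t1\<close> stand for derivatives.
  These occur only multiplied by \<open>s\<close>, so no division is required.\<close>

lemma ladder_step_ring:
  fixes s :: "'a :: comm_ring_1"
  assumes u: "u = uh' + e' * q" and uh: "uh = u' - e' * q" and d: "d = - (e' * C)"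
    and d': "d' = s * A + q * u - C * e - u' * q"
    and f: "s * f1 = - uh * f + d * g + r" and g: "s * g1 = - u * g + e * f + t"
    and r: "s * r1 = u * r + d * t + v * s * f" and t: "s * t1 = uh * t + e * r + v * s * g"
    and f2: "f2 = q * f - C * g" and r2: "r2 = q * r - C * t"
  shows "s * (A * f + q * f1 - C * g1) = - uh' * f2 + d' * f + r2"
    and "s * f1 = - u' * f + e' * f2 + r"
    and "s * (A * r + q * r1 - C * t1) = u' * r2 + d' * r + v * s * f2"
    and "s * r1 = uh' * r + e' * r2 + v * s * f"
proof -
  have "s * (A * f + q * f1 - C * g1) = s * A * f + q * (s * f1) - C * (s * g1)"
    by (simp add: algebra_simps)
  then show "s * (A * f + q * f1 - C * g1) = - uh' * f2 + d' * f + r2"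
    unfolding f g f2 r2 d' d u uh by (simp add: algebra_simps)
  have "s * (A * r + q * r1 - C * t1) = s * A * r + q * (s * r1) - C * (s * t1)"
    by (simp add: algebra_simps)
  then show "s * (A * r + q * r1 - C * t1) = u' * r2 + d' * r + v * s * f2"
    unfolding r t f2 r2 d' d u uh by (simp add: algebra_simps)
  show "s * f1 = - u' * f + e' * f2 + r"
    unfolding f f2 uh d by (simp add: algebra_simps)
  show "s * r1 = uh' * r + e' * r2 + v * s * f"
    unfolding r r2 u d by (simp add: algebra_simps)
qed

lemma pderiv_rec_lin: "pderiv (rec_lin F N * f) = [:rec_A F N:] * f + rec_lin F N * pderiv f"
proof -
  have "pderiv (rec_lin F N) = [:rec_A F N:]"
    by (simp add: pderiv_pCons)
  then show ?thesis
    by (simp only: pderiv_mult ac_simps)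
qed

text \<open>Abel's formula: the sum governs the Casorati determinant of two solutions of the
  relations, which is therefore a multiple of 1/w for every N.\<close>

lemma raise_plus_lower: "raise_lin F N + lower_lin F N = pderiv (sigma F) - tau F"
  by (simp add: raise_lin_def)

lemma ladder_Suc:
  assumes "admissible F" "N > 0" and lad: "ladder F N \<nu> f g r t"
    and f2: "f2 = rec_lin F N * f - smult (rec_C F N) g"
  shows "\<exists>r2. ladder F (Suc N) \<nu> f2 f r2 r"
proof -
  \<comment> \<open>The factor z does not change with N, so \<open>r\<close> obeys the same
    recurrence as \<open>f\<close>.\<close>
  define r2 where "r2 = rec_lin F N * r - [:rec_C F N:] * t"
  have f2': "f2 = rec_lin F N * f - [:rec_C F N:] * g"
    by (simp add: f2)
  have c1: "lower_lin F N = raise_lin F (Suc N) + [:raise_const F (Suc N):] * rec_lin F N"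
    using raise_Suc[OF assms(1,2)] by (simp add: mult.commute)
  have c2: "raise_lin F N = lower_lin F (Suc N) - [:raise_const F (Suc N):] * rec_lin F N"
    using c1 raise_plus_lower[of F N] raise_plus_lower[of F "Suc N"] by (simp add: algebra_simps)
  have c3: "[:lower_const F N:] = - ([:raise_const F (Suc N):] * [:rec_C F N:])"
    using raise_const_Suc[OF assms(1,2)] by (simp add: mult.commute)
  have c4: "[:lower_const F (Suc N):] = sigma F * [:rec_A F N:] + rec_lin F N * lower_lin F N
      - [:rec_C F N:] * [:raise_const F N:] - lower_lin F (Suc N) * rec_lin F N"
    using lower_Suc[OF assms(1,2)] by (simp add: algebra_simps)
  have d: "pderiv f2 = [:rec_A F N:] * f + rec_lin F N * pderiv f - [:rec_C F N:] * pderiv g"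
    "pderiv r2 = [:rec_A F N:] * r + rec_lin F N * pderiv r - [:rec_C F N:] * pderiv t"
    unfolding f2' r2_def pderiv_diff pderiv_rec_lin by (simp_all add: pderiv_smult)
  note lad' = lad[unfolded ladder_def]
  have "ladder F (Suc N) \<nu> f2 f r2 r"
    unfolding ladder_def d
    using ladder_step_ring[OF c1 c2 c3 c4 lad'[THEN conjunct1] lad'[THEN conjunct2, THEN conjunct1]
      lad'[THEN conjunct2, THEN conjunct2, THEN conjunct1]
      lad'[THEN conjunct2, THEN conjunct2, THEN conjunct2] f2' r2_def]
    by blast
  then show ?thesis ..
qed

lemma assoc_Suc:
  "assoc F c (Suc n) = rec_lin F (n + c) * assoc F c n
     - smult (rec_C F (n + c)) (if n = 0 then 0 else assoc F c (n - 1))"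
  by (cases n) auto

text \<open>Let q be a second solution of the relations. Antisymmetrising with z = q_{c-1}, Abel's
  formula makes \<open>f\<close> = w (p_c q_{c-1} - q_c p_{c-1}) constant, normalised to 1, while
  \<open>g\<close> cancels to 0. The raising relation applied to q_{c-1}' and p_{c-1}' then gives
  the stated \<open>r\<close> and \<open>t\<close>.\<close>

lemma ladder_base_assoc:
  assumes "admissible F" "c > 0"
  shows "ladder F c (eigval (sigma F) (tau F) (real c - 1)) 1 0 (raise_lin F c) [:- raise_const F c:]"
proof -
  define W where "W = [:lower_const F c:] * [:- raise_const F c:]"
  have "sigma F * (pderiv (raise_lin F c) - [:eigval (sigma F) (tau F) (real c - 1):])
    = lower_lin F c * raise_lin F c + W"
    using lower_times_raise[OF assms] raise_lower_eigval[of F c]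
    by (simp add: W_def minus_equation_iff diff_conv_add_uminus mult.commute[of "lower_const F c"]
      del: add_uminus_conv_diff)
  then have "sigma F * pderiv (raise_lin F c) = lower_lin F c * raise_lin F c + W
      + [:eigval (sigma F) (tau F) (real c - 1):] * sigma F"
    by (simp add: algebra_simps)
  then show ?thesis
    by (simp add: ladder_def pderiv_pCons W_def mult.commute)
qed

text \<open>For c = 0 take z = 1/w, which solves the classical equation with eigenvalue
  \<lambda>_{-1} = \<sigma>'' - \<tau>'. Then \<open>f\<close> = p_1, \<open>g\<close> = p_0, and
  \<sigma> w z' = \<sigma>' - \<tau> yields \<open>r\<close> and \<open>t\<close>.\<close>

lemma ladder_base_classical:
  assumes "admissible F"
  shows "ladder F 1 (eigval (sigma F) (tau F) (- 1)) (rec_lin F 0) 1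
    ((pderiv (sigma F) - tau F) * rec_lin F 0) (pderiv (sigma F) - tau F)"
proof -
  define K q s u d e A v where "K = pderiv (sigma F) - tau F" and "q = rec_lin F 0"
    and "s = sigma F" and "u = lower_lin F 1" and "d = [:lower_const F 1:]"
    and "e = [:raise_const F 1:]" and "A = [:rec_A F 0:]"
    and "v = [:eigval (sigma F) (tau F) (- 1):]"
  have raise: "raise_lin F 1 = K - u"
    by (simp add: raise_lin_def K_def u_def)
  have "K - u + e * q = 0"
    using raise_one[OF assms] unfolding raise by (simp add: e_def q_def mult.commute)
  then have 1: "u = K + e * q"
    by (simp add: algebra_simps)
  have "s * A = u * q + d"
    using lower_one[OF assms] by (simp add: s_def A_def u_def q_def d_def)
  then have 2: "d = s * A - u * q"
    by (simp add: algebra_simps)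
  have 3: "pderiv K = v"
    unfolding K_def pderiv_diff pderiv2_sigma pderiv_tau v_def by (simp add: eigval_minus_1)
  have 4: "pderiv q = A"
    by (simp add: q_def A_def pderiv_pCons)
  show ?thesis
    unfolding ladder_def raise
    unfolding K_def[symmetric] v_def[symmetric]
    unfolding q_def[symmetric] s_def[symmetric] u_def[symmetric] d_def[symmetric]
      e_def[symmetric] pderiv_mult 3 4 pderiv_1
    unfolding 2 1 by (simp add: algebra_simps)
qed

text \<open>Only the index of y moves in the induction, so the eigenvalue of z stays
  \<lambda>_{c-1}.\<close>

lemma ladder_assoc:
  assumes "admissible F" "n + c > 0"
  shows "\<exists>r t. ladder F (n + c) (eigval (sigma F) (tau F) (real c - 1))
    (assoc F c n) (if n = 0 then 0 else assoc F c (n - 1)) r t"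
  using assms(2)
proof (induction n)
  case 0
  then have "ladder F c (eigval (sigma F) (tau F) (real c - 1)) 1 0 (raise_lin F c) [:- raise_const F c:]"
    by (intro ladder_base_assoc assms(1)) simp
  then show ?case
    by (intro exI) simp
next
  case (Suc n)
  show ?case
  proof (cases "n + c = 0")
    \<comment> \<open>The ladder refers to p_{N-1} and so begins at N = 1; for c = 0 the induction
      starts at n = 1.\<close>
    case True
    then have "n = 0" "c = 0" by auto
    then show ?thesis
      using ladder_base_classical[OF assms(1)] by (intro exI) simp
  next
    case False
    with Suc.IH obtain r t where "ladder F (n + c) (eigval (sigma F) (tau F) (real c - 1))
      (assoc F c n) (if n = 0 then 0 else assoc F c (n - 1)) r t"
      by blast
    from ladder_Suc[OF assms(1) _ this assoc_Suc] False
    obtain r' where "ladder F (Suc (n + c)) (eigval (sigma F) (tau F) (real c - 1))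
      (assoc F c (Suc n)) (assoc F c n) r' r"
      by blast
    then show ?thesis
      by (intro exI) simp
  qed
qed

text \<open>The relations for \<open>k\<close> and \<open>h\<close> are checked after multiplication
  by \<sigma>, where the ladder replaces every derivative; then the nonzero \<sigma> is
  cancelled.\<close>

lemma fourth_order_eq_ladder:
  assumes "admissible F" "n + c > 0"
    and lad: "ladder F (n + c) (eigval (sigma F) (tau F) (real c - 1)) f g r t"
  shows "fourth_order_eq (sigma F) (tau F) c n f"
proof -
  define s T N l m where "s = sigma F" and "T = tau F" and "N = n + c"
    and "l = eigval (sigma F) (tau F) (real c - 1)" and "m = eigval (sigma F) (tau F) (real (n + c))"
  define k where "k = s * pderiv f + (pderiv s - T) * f"
  define h where "h = pderiv r - smult l f"
  define u uh d e L M where "u = lower_lin F N" and "uh = raise_lin F N" and "d = [:lower_const F N:]"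
    and "e = [:raise_const F N:]" and "L = [:l:]" and "M = [:m:]"
  note abbr = s_def[symmetric] N_def[symmetric] l_def[symmetric] u_def[symmetric] uh_def[symmetric]
    d_def[symmetric] e_def[symmetric] L_def[symmetric]
  have f: "s * pderiv f = - uh * f + d * g + r" and g: "s * pderiv g = - u * g + e * f + t"
    and r: "s * pderiv r = u * r + d * t + L * s * f" and t: "s * pderiv t = uh * t + e * r + L * s * g"
    using lad[unfolded ladder_def l_def[symmetric], unfolded abbr] by blast+
  have ul: "pderiv s - T = uh + u"
    by (simp add: raise_plus_lower uh_def u_def s_def T_def)
  have "u * uh - d * e = s * (pderiv u - M)"
    using lower_times_raise[OF assms(1,2)]
    by (simp add: u_def uh_def d_def e_def M_def s_def m_def N_def mult.commute)
  \<comment> \<open>This is where the eigenvalue \<open>m\<close> of y enters; \<open>l\<close>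
    comes in through the ladder.\<close>
  then have ud: "s * pderiv u = u * uh - d * e + s * M"
    by (simp add: algebra_simps)
  have k: "k = u * f + d * g + r"
    unfolding k_def ul f by (simp add: algebra_simps)
  have dk: "pderiv k = pderiv u * f + u * pderiv f + d * pderiv g + pderiv r"
    unfolding k by (simp add: pderiv_add pderiv_mult d_def pderiv_smult)
  have "s * pderiv k = s * pderiv u * f + u * (s * pderiv f) + d * (s * pderiv g) + s * pderiv r"
    unfolding dk by (simp add: algebra_simps)
  also have "\<dots> = s * ((M - L) * f) + 2 * (u * r + d * t + L * s * f)"
    unfolding f g r ud by (simp add: algebra_simps)
  also have "\<dots> = s * ((M - L) * f + 2 * pderiv r)"
    unfolding r[symmetric] by (simp add: algebra_simps)
  finally have k': "pderiv k = smult (m - l) f + 2 * pderiv r"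
    using sigma_nonzero[of F] by (simp add: s_def M_def L_def)
  have sh: "s * h = u * r + d * t"
  proof -
    have "s * h = s * pderiv r - L * s * f"
      by (simp add: h_def L_def algebra_simps)
    then show ?thesis
      by (simp add: r)
  qed
  have "pderiv (s * h) = pderiv u * r + u * pderiv r + d * pderiv t"
    unfolding sh by (simp add: pderiv_add pderiv_mult d_def pderiv_smult)
  then have dsh: "s * pderiv h = pderiv u * r + u * pderiv r + d * pderiv t - pderiv s * h"
    by (simp add: pderiv_mult algebra_simps)
  have "s * (s * pderiv h + T * h)
    = s * pderiv u * r + u * (s * pderiv r) + d * (s * pderiv t) - (pderiv s - T) * (s * h)"
    unfolding dsh by (simp add: algebra_simps)
  also have "\<dots> = s * ((M - L) * r + L * k)"
    unfolding r t ul sh k ud by (simp add: algebra_simps)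
  finally have h': "s * pderiv h + T * h = smult (m - l) r + smult l k"
    using sigma_nonzero[of F] by (simp add: s_def M_def L_def)
  show ?thesis
    unfolding s_def[symmetric] T_def[symmetric]
  proof (rule fourth_order_eq_pairI[OF _ _ _ _ k_def k' h_def h'])
    show "pderiv (pderiv s) = [:d2 s:]" "pderiv T = [:d1 T:]"
      by (simp_all only: s_def T_def pderiv2_sigma pderiv_tau)
    show "l = eigval s T (real c - 1)" "m = eigval s T (real (n + c))"
      by (simp_all only: s_def T_def l_def m_def)
  qed
qed

theorem fourth_order_eq_assoc:
  assumes "admissible F"
  shows "fourth_order_eq (sigma F) (tau F) c n (assoc F c n)"
proof (cases "n + c = 0")
  \<comment> \<open>Here p = 1 and \<lambda>_0 = 0, so only the right-hand side is left: l^2 - l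
    \<sigma>'' + \<tau>' (\<sigma>'' - \<tau>'), which is 0 for l = \<sigma>'' - \<tau>'.\<close>
  case True
  then show ?thesis
    by (simp add: fourth_order_eq_def eigval_0 eigval_minus_1 Let_def eval_nat_numeral)
       (simp add: algebra_simps)
next
  case False
  then show ?thesis
    using ladder_assoc[OF assms, of n c] fourth_order_eq_ladder[OF assms, of n c] by auto
qed

section \<open>Action of the operators on the top coefficient\<close>

lemma coeff_higher_pderiv_top:
  fixes p :: "real poly"
  assumes "j \<le> n"
  shows "coeff ((pderiv ^^ j) p) (n - j) = (\<Prod>i<j. real n - real i) * coeff p n"
  using assms
proof (induction j)
  case (Suc j)
  then have "Suc (n - Suc j) = n - j" by simp
  with Suc show ?case
    by (simp add: coeff_pderiv of_nat_diff)
qed simp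

text \<open>The j-th derivative lowers the degree by j and \<open>q\<close> restores at most j, so
  only \<open>coeff q j\<close> reaches degree n. For j > n both sides vanish, the product
  containing the factor with i = n.\<close>

lemma mult_higher_pderiv_top:
  fixes p q :: "real poly"
  assumes "degree p \<le> n" "degree q \<le> j"
  shows "degree (q * (pderiv ^^ j) p) \<le> n"
    and "coeff (q * (pderiv ^^ j) p) n = coeff q j * ((\<Prod>i<j. real n - real i) * coeff p n)"
proof -
  show "degree (q * (pderiv ^^ j) p) \<le> n"
  proof (cases "j \<le> n")
    case True
    have "degree (q * (pderiv ^^ j) p) \<le> degree q + degree ((pderiv ^^ j) p)"
      by (rule degree_mult_le)
    also have "\<dots> \<le> n"
      using degree_higher_pderiv[of j p] assms True by linarith
    finally show ?thesis .
  next
    case False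
    then have "(pderiv ^^ j) p = 0"
      using assms by (intro poly_eqI) (simp add: coeff_higher_pderiv coeff_eq_0)
    then show ?thesis by simp
  qed
  show "coeff (q * (pderiv ^^ j) p) n = coeff q j * ((\<Prod>i<j. real n - real i) * coeff p n)"
  proof (cases "j \<le> n")
    case True
    have "coeff (q * (pderiv ^^ j) p) n = (\<Sum>i\<le>n. coeff q i * coeff ((pderiv ^^ j) p) (n - i))"
      by (rule coeff_mult)
    also have "\<dots> = (\<Sum>i\<in>{j}. coeff q i * coeff ((pderiv ^^ j) p) (n - i))"
    proof (rule sum.mono_neutral_right)
      show "\<forall>i\<in>{..n} - {j}. coeff q i * coeff ((pderiv ^^ j) p) (n - i) = 0"
      proof
        fix i assume i: "i \<in> {..n} - {j}"
        show "coeff q i * coeff ((pderiv ^^ j) p) (n - i) = 0"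
        proof (cases "i < j")
          case True
          then have "degree ((pderiv ^^ j) p) < n - i"
            using degree_higher_pderiv[of j p] assms \<open>j \<le> n\<close> by linarith
          then show ?thesis by (simp add: coeff_eq_0)
        next
          case False
          with i assms show ?thesis by (simp add: coeff_eq_0)
        qed
      qed
    qed (use True in auto)
    finally show ?thesis
      by (simp add: coeff_higher_pderiv_top[OF True])
  next
    case False
    then have "(pderiv ^^ j) p = 0"
      using assms by (intro poly_eqI) (simp add: coeff_higher_pderiv coeff_eq_0)
    moreover have "(\<Prod>i<j. real n - real i) = 0"
      using False by (auto intro!: bexI[of _ n])
    ultimately show ?thesis by simp
  qed
qed

lemma prod_ffact_numeral:
  "(\<Prod>i<2. x - real i) = x * (x - 1)"
  "(\<Prod>i<3. x - real i) = x * (x - 1) * (x - 2)"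
  "(\<Prod>i<4. x - real i) = x * (x - 1) * (x - 2) * (x - 3)"
  by (simp_all add: eval_nat_numeral)

lemma op_B_top:
  assumes \<sigma>: "\<sigma> = [:a0, a1, a2:]" and p: "degree p \<le> n"
  shows "degree (op_B \<sigma> p) \<le> n" and "coeff (op_B \<sigma> p) n = d2 \<sigma> * (real n + 1)\<^sup>2 * coeff p n"
proof -
  have 2: "degree (2 * \<sigma>) \<le> 2" "coeff (2 * \<sigma>) 2 = d2 \<sigma>"
    by (simp_all add: \<sigma> numeral_poly d2_def pderiv_pCons eval_nat_numeral)
  have 1: "degree (3 * pderiv \<sigma>) \<le> 1" "coeff (3 * pderiv \<sigma>) 1 = 3 * d2 \<sigma>"
    by (simp_all add: \<sigma> numeral_poly d2_def pderiv_pCons)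
  note m2 = mult_higher_pderiv_top[OF p 2(1)] and m1 = mult_higher_pderiv_top[OF p 1(1)]
  have B: "op_B \<sigma> p = (2 * \<sigma>) * (pderiv ^^ 2) p + (3 * pderiv \<sigma>) * (pderiv ^^ 1) p + smult (d2 \<sigma>) p"
    by (simp add: op_B_def)
  show "degree (op_B \<sigma> p) \<le> n"
    unfolding B using m2(1) m1(1) p
    by (intro degree_add_le) (auto intro: order.trans[OF degree_smult_le])
  show "coeff (op_B \<sigma> p) n = d2 \<sigma> * (real n + 1)\<^sup>2 * coeff p n"
    unfolding B coeff_add coeff_smult m2(2) m1(2) prod_ffact_numeral 2(2) 1(2)
    by (simp add: algebra_simps power2_eq_square)
qed

text \<open>The factored form exhibits the diagonal entry as -\<lambda>_n^+ \<lambda>_n^-; the entry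
  of \<open>op_B\<close> is the sum \<lambda>_n^+ + \<lambda>_n^-.\<close>

lemma op_A_top:
  assumes \<sigma>: "\<sigma> = [:a0, a1, a2:]" and \<tau>: "\<tau> = [:b0, b1:]" and p: "degree p \<le> n"
  defines "x \<equiv> real n + 1" and "s \<equiv> d2 \<sigma>" and "t \<equiv> d1 \<tau>"
  shows "degree (op_A \<sigma> \<tau> c p) \<le> n"
    and "coeff (op_A \<sigma> \<tau> c p) n
      = x\<^sup>2 / 4 * ((2 * real c - 3 + x) * s + 2 * t) * ((2 * real c - 3 - x) * s + 2 * t) * coeff p n"
proof -
  define l q4 q3 q2 q1 where "l = eigval \<sigma> \<tau> (real c - 1)"
    and "q4 = \<sigma>\<^sup>2" and "q3 = 5 * \<sigma> * pderiv \<sigma>"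
    and "q2 = \<tau>\<^sup>2 + smult (2 * t) \<sigma> - 2 * \<tau> * pderiv \<sigma> - smult (6 * s) \<sigma> + smult (4 * l) \<sigma> - 3 * (pderiv \<sigma>)\<^sup>2"
    and "q1 = 3 * (smult t \<tau> + smult (2 * l) (pderiv \<sigma>) - smult s (\<tau> + pderiv \<sigma>))"
  have A: "op_A \<sigma> \<tau> c p = - (q4 * (pderiv ^^ 4) p) - q3 * (pderiv ^^ 3) p + q2 * (pderiv ^^ 2) p
      + q1 * (pderiv ^^ 1) p + smult (2 * l * s - t * (s - t)) p"
    by (simp add: op_A_def Let_def q4_def q3_def q2_def q1_def l_def s_def t_def)
  have st: "s = 2 * a2" "t = b1"
    by (simp_all add: s_def t_def \<sigma> \<tau> d2_def d1_def pderiv_pCons)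
  have \<sigma>': "pderiv \<sigma> = [:a1, 2 * a2:]"
    by (simp add: \<sigma> pderiv_pCons)
  have 4: "degree q4 \<le> 4" "coeff q4 4 = s\<^sup>2 / 4"
    by (simp_all add: q4_def \<sigma> st power2_eq_square eval_nat_numeral)
  have 3: "degree q3 \<le> 3" "coeff q3 3 = 5 * s\<^sup>2 / 2"
    by (simp_all add: q3_def \<sigma> \<sigma>'[unfolded \<sigma>] st power2_eq_square numeral_poly eval_nat_numeral)
  have 2: "degree q2 \<le> 2" "coeff q2 2 = t\<^sup>2 + t * s - 2 * t * s - 3 * s\<^sup>2 + 2 * l * s - 3 * s\<^sup>2"
    by (simp_all add: q2_def \<sigma> \<sigma>'[unfolded \<sigma>] \<tau> st power2_eq_square numeral_poly eval_nat_numeral)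
  have 1: "degree q1 \<le> 1" "coeff q1 1 = 3 * (t\<^sup>2 + 2 * l * s - (t + s) * s)"
    by (simp_all add: q1_def \<sigma> \<sigma>'[unfolded \<sigma>] \<tau> st power2_eq_square numeral_poly eval_nat_numeral algebra_simps)
  note m4 = mult_higher_pderiv_top[OF p 4(1)] and m3 = mult_higher_pderiv_top[OF p 3(1)]
    and m2 = mult_higher_pderiv_top[OF p 2(1)] and m1 = mult_higher_pderiv_top[OF p 1(1)]
  show "degree (op_A \<sigma> \<tau> c p) \<le> n"
    unfolding A using m4(1) m3(1) m2(1) m1(1) p
    by (intro degree_add_le degree_diff_le) (auto intro: order.trans[OF degree_smult_le])
  have l: "l = (real c - 1) / 2 * ((real c - 2) * s + 2 * t)"
    by (simp add: l_def eigval_def s_def t_def)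
  have n: "real n = x - 1"
    by (simp add: x_def)
  have "coeff (op_A \<sigma> \<tau> c p) n = (- (s\<^sup>2 / 4 * ((x - 1) * (x - 2) * (x - 3) * (x - 4)))
      - 5 * s\<^sup>2 / 2 * ((x - 1) * (x - 2) * (x - 3))
      + (t\<^sup>2 + t * s - 2 * t * s - 3 * s\<^sup>2 + 2 * l * s - 3 * s\<^sup>2) * ((x - 1) * (x - 2))
      + 3 * (t\<^sup>2 + 2 * l * s - (t + s) * s) * (x - 1) + (2 * l * s - t * (s - t))) * coeff p n"
    unfolding A coeff_add coeff_diff coeff_minus m4(2) m3(2) m2(2) m1(2) coeff_smult prod_ffact_numeral 4(2) 3(2) 2(2) 1(2) n
    by (simp add: n field_simps)
  also have "\<dots> = x\<^sup>2 / 4 * ((2 * real c - 3 + x) * s + 2 * t) * ((2 * real c - 3 - x) * s + 2 * t) * coeff p n"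
    unfolding l by (simp add: field_simps power2_eq_square)
  finally show "coeff (op_A \<sigma> \<tau> c p) n = \<dots>" .
qed

lemma op_A_add: "op_A \<sigma> \<tau> c (p + q) = op_A \<sigma> \<tau> c p + op_A \<sigma> \<tau> c q"
  by (simp add: op_A_def Let_def eval_nat_numeral pderiv_add algebra_simps smult_add_right)

lemma op_A_smult: "op_A \<sigma> \<tau> c (smult k p) = smult k (op_A \<sigma> \<tau> c p)"
  by (simp add: op_A_def Let_def eval_nat_numeral pderiv_smult smult_add_right smult_diff_right mult.commute)

lemma op_B_add: "op_B \<sigma> (p + q) = op_B \<sigma> p + op_B \<sigma> q"
  by (simp add: op_B_def eval_nat_numeral pderiv_add algebra_simps smult_add_right)

lemma op_B_smult: "op_B \<sigma> (smult k p) = smult k (op_B \<sigma> p)"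
  by (simp add: op_B_def eval_nat_numeral pderiv_smult smult_add_right mult.commute)

section \<open>Triangular operators on polynomials\<close>

locale triangular =
  fixes T :: "'a :: field poly \<Rightarrow> 'a poly" and t :: "nat \<Rightarrow> 'a"
  assumes add: "T (p + q) = T p + T q"
    and smult: "T (smult k p) = smult k (T p)"
    and degree_le: "degree p \<le> n \<Longrightarrow> degree (T p) \<le> n"
    and coeff_top: "degree p \<le> n \<Longrightarrow> coeff (T p) n = t n * coeff p n"
begin

lemma zero: "T 0 = 0"
  using smult[of 0 0] by simp

lemma kernel_trivial:
  assumes "\<And>k. k < n \<Longrightarrow> t k \<noteq> 0" "T p = 0" "p = 0 \<or> degree p < n"
  shows "p = 0"
proof (rule ccontr)
  assume "p \<noteq> 0"
  then have "t (degree p) * lead_coeff p \<noteq> 0"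
    using assms by simp
  then show False
    using coeff_top[of p "degree p"] assms(2) by simp
qed

text \<open>Back substitution from the top coefficient. The alternative \<open>q = 0\<close> is
  needed to express "degree below n" at n = 0, since the zero polynomial has degree 0.\<close>

lemma surj_below:
  assumes "\<And>k. k < n \<Longrightarrow> t k \<noteq> 0" "q = 0 \<or> degree q < n"
  obtains p where "T p = q" "p = 0 \<or> degree p < n"
proof -
  have "\<exists>p. T p = q \<and> (p = 0 \<or> degree p < n)"
    using assms
  proof (induction n arbitrary: q)
    case 0
    then show ?case using zero by auto
  next
    case (Suc n)
    define m where "m = monom (coeff q n / t n) n"
    have m: "degree m \<le> n"
      by (simp add: m_def degree_monom_le)
    have "degree (q - T m) \<le> n"
      using Suc.prems(2) degree_le[OF m] by (intro degree_diff_le) auto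
    moreover have "coeff (q - T m) n = 0"
      using coeff_top[OF m] Suc.prems(1)[of n] by (simp add: m_def)
    ultimately have "q - T m = 0 \<or> degree (q - T m) < n"
      by (metis leading_coeff_0_iff le_neq_implies_less)
    with Suc.IH Suc.prems(1) obtain p where p: "T p = q - T m" "p = 0 \<or> degree p < n"
      by (metis less_SucI)
    have "T (p + m) = q"
      by (simp add: add p)
    moreover have "degree (p + m) < Suc n"
      using p(2) m by (auto intro!: le_imp_less_Suc degree_add_le)
    ultimately show ?case by blast
  qed
  with that show thesis by blast
qed

text \<open>As \<open>t n = 0\<close>, the image of x^n has degree below n and is also the image of
  some \<open>p\<close> of lower degree; x^n - p is the kernel element.\<close>

lemma ex_kernel:
  assumes "\<And>k. k < n \<Longrightarrow> t k \<noteq> 0" "t n = 0"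
  shows "\<exists>p. p \<noteq> 0 \<and> degree p = n \<and> T p = 0"
proof -
  let ?m = "monom 1 n :: 'a poly"
  have m: "degree ?m \<le> n"
    by (simp add: degree_monom_le)
  have "T ?m = 0 \<or> degree (T ?m) < n"
    using degree_le[OF m] coeff_top[OF m] assms(2)
    by (metis leading_coeff_0_iff le_neq_implies_less mult_zero_left)
  with surj_below assms(1) obtain p where p: "T p = T ?m" "p = 0 \<or> degree p < n"
    by metis
  have c: "coeff (?m + smult (- 1) p) n = 1"
    using p(2) by (auto simp: coeff_eq_0)
  have "degree (?m + smult (- 1) p) \<le> n"
    using m p(2) by (intro degree_add_le) auto
  moreover have "n \<le> degree (?m + smult (- 1) p)"
    using c by (intro le_degree) simp
  moreover have "T (?m + smult (- 1) p) = 0"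
    unfolding add smult by (simp add: p)
  moreover have "?m + smult (- 1) p \<noteq> 0"
    using c by (metis coeff_0 zero_neq_one)
  ultimately show ?thesis
    by (metis order.antisym)
qed

text \<open>Scaling \<open>q\<close> to the leading coefficient of \<open>p\<close> makes their
  difference a kernel element of degree below n.\<close>

lemma kernel_unique:
  assumes "\<And>k. k < n \<Longrightarrow> t k \<noteq> 0" "T p = 0" "T q = 0"
    and "p \<noteq> 0" "q \<noteq> 0" "degree p = n" "degree q = n"
  shows "\<exists>k. k \<noteq> 0 \<and> p = smult k q"
proof -
  define k where "k = lead_coeff p / lead_coeff q"
  have lead: "lead_coeff p \<noteq> 0" "lead_coeff q \<noteq> 0"
    using assms(4,5) by simp_all
  then have "k \<noteq> 0"
    by (simp add: k_def)
  define r where "r = p + smult (- k) q"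
  have "degree r \<le> n"
    unfolding r_def using assms(6,7) by (intro degree_add_le) auto
  moreover have "coeff r n = 0"
    using lead assms(6,7) by (simp add: r_def k_def)
  ultimately have "r = 0 \<or> degree r < n"
    by (metis leading_coeff_0_iff le_neq_implies_less)
  moreover have "T r = 0"
    unfolding r_def add smult by (simp add: assms)
  ultimately have "r = 0"
    using kernel_trivial assms(1) by blast
  then have "p = smult k q"
    by (simp add: r_def)
  with \<open>k \<noteq> 0\<close> show ?thesis by blast
qed

end

section \<open>The quadratic eigenvalue problem\<close>

text \<open>With eigenvalue m - l, the coefficients combine as 4l + 2(m - l) = 2(m + l), 6l + 3(m -
  l) = 3(m + l) and 2l + (m - l) = m + l.\<close>

lemma fourth_order_eq_iff_quadratic_eigen_eq:
  "fourth_order_eq \<sigma> \<tau> c n p \<longleftrightarrow> quadratic_eigen_eq (op_A \<sigma> \<tau> c) (op_B \<sigma>)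
     (eigval \<sigma> \<tau> (real (n + c)) - eigval \<sigma> \<tau> (real c - 1)) p"
proof -
  define l m t s where "l = eigval \<sigma> \<tau> (real c - 1)" and "m = eigval \<sigma> \<tau> (real (n + c))"
    and "t = d1 \<tau>" and "s = d2 \<sigma>"
  define p1 p2 p3 p4 S1 where "p1 = pderiv p" and "p2 = (pderiv ^^ 2) p" and "p3 = (pderiv ^^ 3) p"
    and "p4 = (pderiv ^^ 4) p" and "S1 = pderiv \<sigma>"
  have iff: "a = b \<longleftrightarrow> x = y" if "a - b = x - y" for a b x y :: "real poly"
    using that by auto
  show ?thesis
    unfolding fourth_order_eq_def quadratic_eigen_eq_def op_A_def op_B_def Let_def
      l_def[symmetric] m_def[symmetric] t_def[symmetric] s_def[symmetric]
      p1_def[symmetric] p2_def[symmetric] p3_def[symmetric] p4_def[symmetric] S1_def[symmetric]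
    by (rule iff, rule poly_eqI) (simp add: numeral_poly algebra_simps power2_eq_square)
qed

lemma rec_A_nonzero:
  assumes "admissible F"
  shows "rec_A F n \<noteq> 0"
proof (cases F)
  case (Jacobi \<alpha> \<beta>)
  then show ?thesis
    using assms by (cases "n = 0") auto
qed auto

lemma degree_assoc_le: "degree (assoc F c n) \<le> n"
  and lead_assoc_nonzero: "admissible F \<Longrightarrow> coeff (assoc F c n) n \<noteq> 0"
proof (induction F c n rule: assoc.induct)
  case (3 F c n)
  {
    case 1
    show ?case
      using 3(1,3) by (auto intro!: degree_diff_le degree_add_le
        order.trans[OF degree_smult_le] order.trans[OF degree_pCons_le])
  next
    case 2
    then show ?case
      using 3 rec_A_nonzero by (auto simp: coeff_eq_0)
  }
qed (auto simp: rec_A_nonzero)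

definition eigval_plus :: "real poly \<Rightarrow> real poly \<Rightarrow> nat \<Rightarrow> nat \<Rightarrow> real" where
  "eigval_plus \<sigma> \<tau> c n =
     (real n + 1) / 2 * ((2 * real c - 3 + (real n + 1)) * d2 \<sigma> + 2 * d1 \<tau>)"

definition eigval_minus :: "real poly \<Rightarrow> real poly \<Rightarrow> nat \<Rightarrow> nat \<Rightarrow> real" where
  "eigval_minus \<sigma> \<tau> c n =
     - (real n + 1) / 2 * ((2 * real c - 3 - (real n + 1)) * d2 \<sigma> + 2 * d1 \<tau>)"

lemma eigval_plus_eq:
  "eigval_plus \<sigma> \<tau> c n = eigval \<sigma> \<tau> (real (n + c)) - eigval \<sigma> \<tau> (real c - 1)"
  by (simp add: eigval_plus_def eigval_def field_simps)

lemma sigma_coeffs: "sigma F = [:coeff (sigma F) 0, coeff (sigma F) 1, coeff (sigma F) 2:]"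
  by (cases F) (simp_all add: numeral_2_eq_2)

lemma tau_coeffs: "tau F = [:coeff (tau F) 0, coeff (tau F) 1:]"
  by (cases F) simp_all

text \<open>By Vieta, the entries a_n = -\<lambda>_n^+ \<lambda>_n^- and b_n = \<lambda>_n^+ +
  \<lambda>_n^- turn a_n + b_n l - l^2 into the product shown.\<close>

lemma quadratic_pencil_triangular:
  fixes F c
  defines "\<sigma> \<equiv> sigma F" and "\<tau> \<equiv> tau F"
  shows "triangular (\<lambda>p. op_A \<sigma> \<tau> c p + smult l (op_B \<sigma> p) - smult (l\<^sup>2) p)
    (\<lambda>k. - ((l - eigval_plus \<sigma> \<tau> c k) * (l - eigval_minus \<sigma> \<tau> c k)))"
proof
  note A = op_A_top[OF sigma_coeffs[of F, folded \<sigma>_def] tau_coeffs[of F, folded \<tau>_def], of _ _ c]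
  note B = op_B_top[OF sigma_coeffs[of F, folded \<sigma>_def]]
  fix p :: "real poly" and n
  assume p: "degree p \<le> n"
  show "degree (op_A \<sigma> \<tau> c p + smult l (op_B \<sigma> p) - smult (l\<^sup>2) p) \<le> n"
    using A(1)[OF p] B(1)[OF p] p
    by (intro degree_add_le degree_diff_le) (auto intro: order.trans[OF degree_smult_le])
  show "coeff (op_A \<sigma> \<tau> c p + smult l (op_B \<sigma> p) - smult (l\<^sup>2) p) n
      = - ((l - eigval_plus \<sigma> \<tau> c n) * (l - eigval_minus \<sigma> \<tau> c n)) * coeff p n"
    using A(2)[OF p] B(2)[OF p]
    by (simp add: eigval_plus_def eigval_minus_def field_simps power2_eq_square)
qed (simp_all add: op_A_add op_B_add op_A_smult op_B_smult smult_add_right smult_diff_right mult.commute)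

lemma quadratic_eigenfunction_iff:
  "quadratic_eigenfunction A B n l p \<longleftrightarrow> p \<noteq> 0 \<and> degree p = n \<and> A p + smult l (B p) - smult (l\<^sup>2) p = 0"
  by (simp add: quadratic_eigenfunction_def quadratic_eigen_eq_def)

text \<open>
  The exceptional parameters are those where \<open>\<lambda>\<^sub>n\<^sup>+ = \<lambda>\<^sub>k\<^sup>-\<close> for some \<open>k < n\<close>, that is,
  \<open>n - k = 1 - \<alpha> - \<beta>\<close> with \<open>c = 0\<close>.
\<close>

lemma eigval_plus_simple:
  assumes adm: "admissible F" and k: "k < n"
    and gen: "\<not> (\<exists>\<alpha> \<beta>. F = Jacobi \<alpha> \<beta> \<and> c = 0 \<and>
      (\<alpha> + \<beta> = 0 \<and> n \<ge> 1 \<or> \<alpha> + \<beta> = -1 \<and> n \<ge> 2))"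
  defines "\<sigma> \<equiv> sigma F" and "\<tau> \<equiv> tau F"
  shows "eigval_plus \<sigma> \<tau> c n \<noteq> eigval_plus \<sigma> \<tau> c k" "eigval_plus \<sigma> \<tau> c n \<noteq> eigval_minus \<sigma> \<tau> c k"
proof -
  show "eigval_plus \<sigma> \<tau> c n \<noteq> eigval_plus \<sigma> \<tau> c k"
  proof (cases F)
    case (Jacobi \<alpha> \<beta>)
    have "eigval_plus \<sigma> \<tau> c n - eigval_plus \<sigma> \<tau> c k = (real n - real k) * (real n + real k + 2 * real c + 1 + \<alpha> + \<beta>)"
      by (simp add: Jacobi \<sigma>_def \<tau>_def eigval_plus_def d2_def d1_def pderiv_pCons field_simps)
    \<comment> \<open>Since \<alpha> + \<beta> > -2, the bound n + k \<ge> 1 makes the second factor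
      positive.\<close>
    moreover have "real n + real k \<ge> 1"
      using k by linarith
    then have "real n + real k + 2 * real c + 1 + \<alpha> + \<beta> > 0"
      using adm Jacobi by simp
    ultimately show ?thesis
      using k by auto
  qed (use k in \<open>auto simp: \<sigma>_def \<tau>_def eigval_plus_def d2_def d1_def pderiv_pCons\<close>)
  show "eigval_plus \<sigma> \<tau> c n \<noteq> eigval_minus \<sigma> \<tau> c k"
  proof (cases F)
    case (Jacobi \<alpha> \<beta>)
    have "eigval_plus \<sigma> \<tau> c n - eigval_minus \<sigma> \<tau> c k
      = (real n + real k + 2) * (real n - real k + (2 * real c + \<alpha> + \<beta> - 1))"
      by (simp add: Jacobi \<sigma>_def \<tau>_def eigval_plus_def eigval_minus_def d2_def d1_def pderiv_pCons field_simps)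
    moreover have "real n - real k + (2 * real c + \<alpha> + \<beta> - 1) \<noteq> 0"
    proof
      \<comment> \<open>Here n - k = 1 - 2c - \<alpha> - \<beta> < 3 - 2c, which forces c = 0 and n
        - k = 1 or 2, that is, \<alpha> + \<beta> = 0 or -1.\<close>
      assume eq: "real n - real k + (2 * real c + \<alpha> + \<beta> - 1) = 0"
      have ab: "\<alpha> + \<beta> > - 2"
        using adm Jacobi by simp
      have "c = 0"
      proof (rule ccontr)
        assume "c \<noteq> 0"
        then have "real c \<ge> 1" by simp
        moreover have "real n - real k \<ge> 1"
          using k by linarith
        ultimately show False using eq ab by linarith
      qed
      with eq ab have "real n - real k < 3" by simp
      then have "n = k + 1 \<or> n = k + 2"
        using k by linarith
      then show False
        using eq gen \<open>c = 0\<close> Jacobi by auto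
    qed
    ultimately show ?thesis
      by auto
  qed (use k in \<open>auto simp: \<sigma>_def \<tau>_def eigval_plus_def eigval_minus_def d2_def d1_def pderiv_pCons\<close>)
qed

text \<open>In the Jacobi case the value is (n+1)(2c + n + \<alpha> + \<beta>), positive for c \<ge>
  1 because \<alpha> + \<beta> > -2; Laguerre and Hermite give n+1 and 2(n+1).\<close>

lemma eigval_plus_pos_iff:
  assumes "admissible F"
  shows "eigval_plus (sigma F) (tau F) c n > 0
    \<longleftrightarrow> \<not> (\<exists>\<alpha> \<beta>. F = Jacobi \<alpha> \<beta> \<and> c = 0 \<and> real n + \<alpha> + \<beta> \<le> 0)"
proof (cases F)
  case (Jacobi \<alpha> \<beta>)
  have "eigval_plus (sigma F) (tau F) c n = (real n + 1) * (2 * real c + real n + \<alpha> + \<beta>)"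
    by (simp add: Jacobi eigval_plus_def d2_def d1_def pderiv_pCons field_simps)
  then have "eigval_plus (sigma F) (tau F) c n > 0 \<longleftrightarrow> 2 * real c + real n + \<alpha> + \<beta> > 0"
    by (simp add: zero_less_mult_iff)
  moreover have "2 * real c + real n + \<alpha> + \<beta> > 0" if "c \<noteq> 0"
  proof -
    have "real c \<ge> 1" using that by simp
    then show ?thesis using assms Jacobi by simp
  qed
  ultimately show ?thesis
    using Jacobi by (cases "c = 0") auto
qed (auto simp: eigval_plus_def d2_def d1_def pderiv_pCons)

text \<open>Uniqueness for \<open>lp n\<close> and existence for \<open>lm n\<close> both rest on
  the diagonal entries below degree n being nonzero, whence their conditions on coinciding
  eigenvalues. That \<open>assoc F c n\<close> is an eigenfunction comes from the differential
  equation.\<close>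

theorem theorem1p1:
  fixes F :: classical and c :: nat
    and \<sigma> \<tau> :: "real poly" and \<sigma>'' \<tau>' \<Delta> R :: real and lam :: "real \<Rightarrow> real"
    and A B :: "real poly \<Rightarrow> real poly"
  assumes "admissible F"
    and "\<sigma> = sigma F" and "\<tau> = tau F" and "\<sigma>'' = d2 \<sigma>" and "\<tau>' = d1 \<tau>"
    and "lam = eigval \<sigma> \<tau>"
    and "A = op_A \<sigma> \<tau> c" and "B = op_B \<sigma>"
    and "\<Delta> = (\<sigma>'' - 2 * \<tau>')\<^sup>2 + 8 * lam (real c - 1) * \<sigma>''"
    and "R = (if \<exists>\<alpha> \<beta>. F = Jacobi \<alpha> \<beta> \<and> 2 * real c + \<alpha> + \<beta> < 1 then - sqrt \<Delta> else sqrt \<Delta>)"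
  shows "degree_preserving A \<and> degree_preserving B \<and> \<Delta> \<ge> 0 \<and>
    (\<exists>lp lm :: nat \<Rightarrow> real. \<forall>n.
       quadratic_eigenvalues A B n (lp n) (lm n) \<and>
       (\<forall>l p. quadratic_eigenfunction A B n l p \<longrightarrow> l = lp n \<or> l = lm n) \<and>
       2 * lp n = \<sigma>'' * (real n + 1)\<^sup>2 + (real n + 1) * R \<and>
       2 * lm n = \<sigma>'' * (real n + 1)\<^sup>2 - (real n + 1) * R \<and>
       2 * lp n = (real n + 1) * ((2 * real c - 3 + (real n + 1)) * \<sigma>'' + 2 * \<tau>') \<and>
       2 * lm n = - (real n + 1) * ((2 * real c - 3 - (real n + 1)) * \<sigma>'' + 2 * \<tau>') \<and>
       lp n = lam (real (n + c)) - lam (real c - 1) \<and>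
       (lp n > 0 \<longleftrightarrow> \<not> (\<exists>\<alpha> \<beta>. F = Jacobi \<alpha> \<beta> \<and> c = 0 \<and> real n + \<alpha> + \<beta> \<le> 0)) \<and>
       quadratic_eigenfunction A B n (lp n) (assoc F c n) \<and>
       (\<not> (\<exists>\<alpha> \<beta>. F = Jacobi \<alpha> \<beta> \<and> c = 0 \<and>
              (\<alpha> + \<beta> = 0 \<and> n \<ge> 1 \<or> \<alpha> + \<beta> = -1 \<and> n \<ge> 2)) \<longrightarrow>
          (\<forall>p. quadratic_eigenfunction A B n (lp n) p \<longrightarrow> (\<exists>k. k \<noteq> 0 \<and> p = smult k (assoc F c n)))) \<and>
       ((\<forall>k<n. lm n \<noteq> lp k \<and> lm n \<noteq> lm k) \<longrightarrow>
          (\<exists>p. quadratic_eigenfunction A B n (lm n) p)) \<and>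
       fourth_order_eq \<sigma> \<tau> c n (assoc F c n) \<and>
       (\<forall>p. fourth_order_eq \<sigma> \<tau> c n p \<longleftrightarrow> quadratic_eigen_eq A B (lp n) p))"
proof -
  define lp lm where "lp = eigval_plus \<sigma> \<tau> c" and "lm = eigval_minus \<sigma> \<tau> c"
  have \<Delta>: "\<Delta> = ((2 * real c - 3) * \<sigma>'' + 2 * \<tau>')\<^sup>2"
    unfolding assms(4-6,9) by (simp add: eigval_def field_simps power2_eq_square)
  \<comment> \<open>The root of \<Delta> is an absolute value. In the Jacobi case its argument is
    2(2c + \<alpha> + \<beta> - 1), which explains the sign in \<open>R\<close>; in the other cases
    the argument is 2 or 4.\<close>
  have R: "R = (2 * real c - 3) * \<sigma>'' + 2 * \<tau>'"
  proof (cases F)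
    case (Jacobi \<alpha> \<beta>)
    have "(2 * real c - 3) * \<sigma>'' + 2 * \<tau>' = 2 * (2 * real c + \<alpha> + \<beta> - 1)"
      unfolding assms(2-5) Jacobi by (simp add: d2_def d1_def pderiv_pCons field_simps)
    then show ?thesis
      unfolding assms(10) \<Delta> by (auto simp: Jacobi real_sqrt_abs)
  next
    case (Laguerre \<alpha>)
    then show ?thesis
      unfolding assms(10) \<Delta> unfolding assms(2-5) by (simp add: d2_def d1_def pderiv_pCons)
  next
    case Hermite
    then show ?thesis
      unfolding assms(10) \<Delta> unfolding assms(2-5) by (simp add: d2_def d1_def pderiv_pCons)
  qed
  have tri: "triangular (\<lambda>p. A p + smult l (B p) - smult (l\<^sup>2) p) (\<lambda>k. - ((l - lp k) * (l - lm k)))" for l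
    using quadratic_pencil_triangular[of F c l] unfolding lp_def lm_def assms(2,3,7,8) .
  note A_top = op_A_top[OF sigma_coeffs[of F, folded assms(2)] tau_coeffs[of F, folded assms(3)], of _ _ c, folded assms(7)]
  note B_top = op_B_top[OF sigma_coeffs[of F, folded assms(2)], folded assms(8)]
  have monom: "degree (monom (1 :: real) n) \<le> n" for n
    by (rule degree_monom_le)
  have eigenvalues: "quadratic_eigenvalues A B n (lp n) (lm n)" for n
    unfolding quadratic_eigenvalues_def diag_def A_top(2)[OF monom] B_top(2)[OF monom]
    by (simp add: lp_def lm_def eigval_plus_def eigval_minus_def field_simps power2_eq_square)
  have roots: "l = lp n \<or> l = lm n" if "quadratic_eigenfunction A B n l p" for l n p
  proof -
    interpret triangular "\<lambda>p. A p + smult l (B p) - smult (l\<^sup>2) p" "\<lambda>k. - ((l - lp k) * (l - lm k))"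
      by (rule tri)
    have "p \<noteq> 0" "degree p = n" and 0: "A p + smult l (B p) - smult (l\<^sup>2) p = 0"
      using that by (auto simp: quadratic_eigenfunction_iff)
    \<comment> \<open>The top coefficient of the eigenvalue equation is the diagonal entry times
      this nonzero number.\<close>
    then have "coeff p n \<noteq> 0" by auto
    then show ?thesis
      using coeff_top[of p n] \<open>degree p = n\<close> unfolding 0 by simp
  qed
  have eq: "fourth_order_eq \<sigma> \<tau> c n p \<longleftrightarrow> quadratic_eigen_eq A B (lp n) p" for n p
    unfolding assms(7,8) lp_def eigval_plus_eq by (rule fourth_order_eq_iff_quadratic_eigen_eq)
  have ode: "fourth_order_eq \<sigma> \<tau> c n (assoc F c n)" for n
    unfolding assms(2,3) by (rule fourth_order_eq_assoc[OF assms(1)])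
  have assoc: "quadratic_eigenfunction A B n (lp n) (assoc F c n)" for n
  proof -
    have nz: "coeff (assoc F c n) n \<noteq> 0"
      by (rule lead_assoc_nonzero[OF assms(1)])
    then have "degree (assoc F c n) = n"
      by (intro antisym degree_assoc_le le_degree)
    with nz show ?thesis
      using eq ode by (auto simp: quadratic_eigenfunction_def)
  qed
  have unique: "\<exists>k. k \<noteq> 0 \<and> p = smult k (assoc F c n)"
    if gen: "\<not> (\<exists>\<alpha> \<beta>. F = Jacobi \<alpha> \<beta> \<and> c = 0 \<and> (\<alpha> + \<beta> = 0 \<and> n \<ge> 1 \<or> \<alpha> + \<beta> = -1 \<and> n \<ge> 2))"
      and p: "quadratic_eigenfunction A B n (lp n) p" for n p
  proof -
    interpret triangular "\<lambda>p. A p + smult (lp n) (B p) - smult ((lp n)\<^sup>2) p"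
      "\<lambda>k. - ((lp n - lp k) * (lp n - lm k))"
      by (rule tri)
    show ?thesis
      using p assoc[of n] eigval_plus_simple[OF assms(1) _ gen]
      by (intro kernel_unique[of n])
        (auto simp: quadratic_eigenfunction_iff lp_def lm_def assms(2,3))
  qed
  have minus: "\<exists>p. quadratic_eigenfunction A B n (lm n) p"
    if "\<forall>k<n. lm n \<noteq> lp k \<and> lm n \<noteq> lm k" for n
  proof -
    interpret triangular "\<lambda>p. A p + smult (lm n) (B p) - smult ((lm n)\<^sup>2) p"
      "\<lambda>k. - ((lm n - lp k) * (lm n - lm k))"
      by (rule tri)
    show ?thesis
      unfolding quadratic_eigenfunction_iff using that by (intro ex_kernel) auto
  qed
  have "degree_preserving A" "degree_preserving B"
    unfolding degree_preserving_def using A_top(1)[OF monom] B_top(1)[OF monom] by blast+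
  moreover have "\<Delta> \<ge> 0"
    by (simp add: \<Delta>)
  moreover have two: "2 * lp n = (real n + 1) * ((2 * real c - 3 + (real n + 1)) * \<sigma>'' + 2 * \<tau>')"
    "2 * lm n = - (real n + 1) * ((2 * real c - 3 - (real n + 1)) * \<sigma>'' + 2 * \<tau>')" for n
    by (simp_all add: lp_def lm_def eigval_plus_def eigval_minus_def assms(4,5))
  moreover have "2 * lp n = \<sigma>'' * (real n + 1)\<^sup>2 + (real n + 1) * R"
    "2 * lm n = \<sigma>'' * (real n + 1)\<^sup>2 - (real n + 1) * R" for n
    unfolding two R by (simp_all add: algebra_simps power2_eq_square)
  moreover have "lp n = lam (real (n + c)) - lam (real c - 1)" for n
    unfolding lp_def assms(6) by (rule eigval_plus_eq)
  moreover have "lp n > 0 \<longleftrightarrow> \<not> (\<exists>\<alpha> \<beta>. F = Jacobi \<alpha> \<beta> \<and> c = 0 \<and> real n + \<alpha> + \<beta> \<le> 0)" for n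
    unfolding lp_def assms(2,3) by (rule eigval_plus_pos_iff[OF assms(1)])
  ultimately show ?thesis
    using eigenvalues roots assoc unique minus ode eq
    by (intro conjI exI[of _ lp] exI[of _ lm] allI impI) blast+
qed

end
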